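(* Let $G$ be a non-trivial abelian group, let $k$ be a field, and let $p$ be an odd prime. The group algebra $kG$ is a $\Delta_p$-ring if and only if $p$ is a Mersenne prime and $kG$ is either $\mathbb{F}_2 C_p^r$ or $\mathbb{F}_{p+1} C_p^r$ for some $0 < r \le \infty$ (that is, $k\cong\mathbb{F}_2$ or $k\cong\mathbb{F}_{p+1}$, and $G\cong C_p^r$ for some finite or infinite cardinal $r>0$).
   Context: A ring $R$ is a $\Delta_n$-ring if $u^n=1$ for every unit $u$ of $R$. A Mersenne prime is a prime of the form $2^n-1$ for some positive integer $n$. $C_p$ is the cyclic group of order $p$, and $C_p^r$ denotes the direct sum of $r$ copies of $C_p$. $\mathbb{F}_q$ is the finite field with $q$ elements. *)

theory Defs
  imports
    "HOL-Library.Poly_Mapping"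
    "HOL-Computational_Algebra.Primes"
    "HOL-Algebra.Product_Groups"
begin

text \<open>
  The group algebra \<open>kG\<close> is the type of finitely supported functions from \<open>G\<close> to \<open>k\<close>.
  Since \<open>G\<close> is abelian it is written additively; the ring multiplication of \<^type>\<open>poly_mapping\<close>
  is then the convolution product, and \<open>Poly_Mapping.single g 1\<close> is the copy of \<open>g\<close> in \<open>kG\<close>.
\<close>
type_synonym ('k, 'g) group_algebra = "'g \<Rightarrow>\<^sub>0 'k"

definition delta_ring :: "nat \<Rightarrow> 'a::ring_1 itself \<Rightarrow> bool" where
  "delta_ring n _ \<longleftrightarrow> (\<forall>u::'a. (\<exists>v. u * v = 1 \<and> v * u = 1) \<longrightarrow> u ^ n = 1)"

definition mersenne_prime :: "nat \<Rightarrow> bool" where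
  "mersenne_prime p \<longleftrightarrow> prime p \<and> (\<exists>n>0. p = 2 ^ n - 1)"

text \<open>
  \<open>k\<close> is (a copy of) \<open>\<bbbF>\<^sub>q\<close>: finite fields are determined up to isomorphism by
  their number of elements.
\<close>
definition is_GF :: "nat \<Rightarrow> 'k::field itself \<Rightarrow> bool" where
  "is_GF q _ \<longleftrightarrow> finite (UNIV :: 'k set) \<and> card (UNIV :: 'k set) = q"

text \<open>The group structure of a type, as a record, for use with group isomorphism \<open>\<cong>\<close>.\<close>
definition type_group :: "'g::group_add itself \<Rightarrow> 'g monoid" where
  "type_group _ = \<lparr>carrier = UNIV, monoid.mult = (+), one = 0\<rparr>"

text \<open>
  \<open>C\<^sub>p\<^sup>r\<close> for the cardinal \<open>r = |I|\<close>. To say that a group \<open>G\<close> is isomorphic to some \<open>C\<^sub>p\<^sup>r\<close>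
  (\<open>p \<ge> 2\<close>) it suffices to let \<open>I\<close> range over the sets of elements of \<open>G\<close>: the
  canonical generators of the summands correspond to \<open>r\<close> distinct elements of \<open>G\<close>.
\<close>
definition cyclic_sum :: "nat \<Rightarrow> 'i set \<Rightarrow> ('i \<Rightarrow> int) monoid" where
  "cyclic_sum p I = sum_group I (\<lambda>_. integer_mod_group p)"

end

theory Submission
  imports Defs "HOL-Number_Theory.Residues" "HOL-Computational_Algebra.Polynomial"
begin

text \<open>
  Suppose that \<open>kG\<close> is a \<open>\<Delta>\<^sub>p\<close>-ring. The multiples \<open>c g\<close> of group elements by nonzero scalars are
  units of \<open>kG\<close>, so \<open>c\<^sup>p = 1\<close> for all nonzero scalars and \<open>g\<^sup>p = 1\<close> in \<open>G\<close>. Since \<open>p\<close> is odd, \<open>c = -1\<close>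
  shows that \<open>k\<close> has characteristic 2. The nonzero scalars are at most \<open>p\<close> in number, being roots of
  \<open>X\<^sup>p - 1\<close>, and if one of them is not 1 then its powers already exhaust \<open>p\<close> scalars, so \<open>k\<close> has 2 or
  \<open>p + 1\<close> elements (\<open>is_GF_if_nonzero_power_prime_eq_1\<close>). The group \<open>G\<close> is a vector space over the
  prime field with \<open>p\<close> elements, and a basis of it gives an isomorphism with some \<open>C\<^sub>p\<^sup>r\<close>
  (\<open>exponent_imp_iso_cyclic_sum\<close>).

  That \<open>p\<close> is a Mersenne prime can be seen without decomposing \<open>kG\<close> into fields. If \<open>a\<^sup>N = a\<close> for some
  \<open>N \<ge> 3\<close>, then \<open>e = a\<^sup>N\<^sup>-\<^sup>1\<close> is an idempotent and \<open>u = a + 1 - e\<close> is a unit with \<open>a u = a\<^sup>2\<close>; hence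
  \<open>a = a u\<^sup>p = a\<^sup>p\<^sup>+\<^sup>1\<close> (\<open>delta_ring_power_Suc_eq_same\<close>). The Frobenius map and Fermat's little theorem
  show that \<open>a = 1 + g\<close> satisfies the hypothesis with \<open>N = 2\<^sup>p\<^sup>-\<^sup>1\<close>. So \<open>(1 + g)\<^sup>p\<^sup>+\<^sup>1 = 1 + g\<close>, where
  \<open>g\<close> has order \<open>p\<close>, and comparing coefficients forces \<open>p + 1\<close> to be a power of 2
  (\<open>mersenne_prime_if_delta_ring\<close>).

  Conversely let \<open>p + 1 = 2\<^sup>n\<close>. Every scalar \<open>c\<close> has \<open>c\<^sup>p\<^sup>+\<^sup>1 = c\<close> and every \<open>g \<in> G\<close> has
  \<open>g\<^sup>p\<^sup>+\<^sup>1 = g\<close>; the \<open>2\<^sup>n\<close>-th power map is additive on \<open>kG\<close>, so it fixes every element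
  (\<open>group_algebra_power_eq_same\<close>), and cancelling a unit \<open>u\<close> in \<open>u\<^sup>p\<^sup>+\<^sup>1 = u\<close> gives \<open>u\<^sup>p = 1\<close>.
\<close>

section \<open>Abelian groups as modules over the integers\<close>

text \<open>
  The power in the group record, read additively. As a scalar action of the integers it makes the
  theory of spans of the locale \<^locale>\<open>Modules.module\<close> available for \<open>G\<close>. The prime field would be
  the natural scalar ring, but it depends on \<open>p\<close> and so is not a type.
\<close>

definition int_mult :: "int \<Rightarrow> 'g::ab_group_add \<Rightarrow> 'g" where
  "int_mult n g = g [^]\<^bsub>type_group TYPE('g)\<^esub> n"

lemma comm_group_type_group: "comm_group (type_group TYPE('g::ab_group_add))"
proof (rule comm_groupI)
  fix x :: 'g
  show "\<exists>y\<in>carrier (type_group TYPE('g)). y \<otimes>\<^bsub>type_group TYPE('g)\<^esub> x = \<one>\<^bsub>type_group TYPE('g)\<^esub>"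
    by (rule bexI[of _ "- x"]) (simp_all add: type_group_def)
qed (simp_all add: type_group_def add_ac)

interpretation zmod: Modules.module "int_mult :: int \<Rightarrow> 'g::ab_group_add \<Rightarrow> 'g"
proof -
  interpret G: comm_group "type_group TYPE('g)"
    by (rule comm_group_type_group)
  have [simp]: "x \<in> carrier (type_group TYPE('g))" for x
    by (simp add: type_group_def)
  have add: "x \<otimes>\<^bsub>type_group TYPE('g)\<^esub> y = x + y" for x y
    by (simp add: type_group_def)
  show "Modules.module (int_mult :: int \<Rightarrow> 'g \<Rightarrow> 'g)"
    by unfold_locales
      (simp_all add: int_mult_def G.int_pow_mult G.int_pow_distrib G.int_pow_pow mult.commute
        flip: add)
qed

text \<open>An integer prime to the exponent acts invertibly: Bezout's identity gives the inverse.\<close>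

lemma int_mult_left_inverse:
  fixes g :: "'g::ab_group_add"
  assumes "prime p" "int_mult (int p) g = 0" "\<not> int p dvd c"
  obtains b where "int_mult b (int_mult c g) = g"
proof -
  have "coprime (int p) c"
    using assms by (intro prime_imp_coprime) auto
  then obtain a b where "a * int p + b * c = 1"
    using bezout_int[of "int p" c] by auto
  then have "g = int_mult (a * int p + b * c) g"
    by simp
  also have "\<dots> = int_mult a (int_mult (int p) g) + int_mult b (int_mult c g)"
    by (simp add: zmod.scale_left_distrib)
  finally show thesis
    using assms(2) that[of b] by simp
qed

lemma int_mult_cong:
  fixes g :: "'g::ab_group_add"
  assumes "int_mult (int p) g = 0" "[a = b] (mod int p)"
  shows "int_mult a g = int_mult b g"
proof -
  obtain k where "b = a + int p * k"
    using assms(2) by (auto simp: cong_iff_lin)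
  then show ?thesis
    using assms(1) by (simp add: zmod.scale_left_distrib mult.commute[of "int p"] flip: zmod.scale_scale)
qed

section \<open>Abelian groups of prime exponent\<close>

text \<open>
  A basis over the prime field is read off from a well-ordering of the group: it consists of the
  elements that are not in the span of their predecessors. Well-founded induction shows that it
  spans. In a nontrivial relation, the greatest element with a coefficient prime to \<open>p\<close> would be
  in the span of its predecessors. Independence is stated with divisibility by \<open>p\<close> because the
  integer coefficients matter only modulo \<open>p\<close>.
\<close>

lemma exists_independent_spanning_set:
  assumes "prime p" and exp: "\<And>g::'g::ab_group_add. int_mult (int p) g = 0"
  shows "\<exists>I::'g set. zmod.span I = UNIV \<and>
    (\<forall>F c. finite F \<and> F \<subseteq> I \<and> (\<Sum>i\<in>F. int_mult (c i) i) = 0 \<longrightarrow> (\<forall>i\<in>F. int p dvd c i))"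
proof -
  obtain r :: "'g rel" where r: "Well_order r" "Field r = UNIV"
    using well_ordering[where 'a='g] by (elim exE conjE)
  define R where "R = r - Id"
  have "wf R" "trans R" "total R"
    using r by (auto simp: R_def order_on_defs trans_diff_Id total_on_diff_Id)
  define I where "I = {g. g \<notin> zmod.span {h. (h, g) \<in> R}}"
  have "g \<in> zmod.span I" for g
    using \<open>wf R\<close>
  proof (induction g)
    case (less g)
    show ?case
    proof (cases "g \<in> I")
      case False
      then have "g \<in> zmod.span {h. (h, g) \<in> R}"
        by (simp add: I_def)
      also have "\<dots> \<subseteq> zmod.span I"
        using less by (intro zmod.span_minimal) auto
      finally show ?thesis .
    qed (simp add: zmod.span_base)
  qed
  then have span: "zmod.span I = UNIV"
    by auto
  have indep: "\<forall>i\<in>F. int p dvd c i"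
    if F: "finite F" "F \<subseteq> I" and 0: "(\<Sum>i\<in>F. int_mult (c i) i) = 0" for F c
  proof (rule ccontr)
    assume nontrivial: "\<not> (\<forall>i\<in>F. int p dvd c i)"
    define S where "S = {i \<in> F. \<not> int p dvd c i}"
    have S: "finite S" "S \<noteq> {}"
      using F nontrivial by (auto simp: S_def)
    obtain m where "m \<in> S" and m: "\<And>i. i \<in> S \<Longrightarrow> i \<noteq> m \<Longrightarrow> (i, m) \<in> R"
    proof -
      have "transp_on S (\<lambda>x y. (x, y) \<in> R)"
        using \<open>trans R\<close> unfolding transp_on_def trans_def by blast
      moreover have "totalp_on S (\<lambda>x y. (x, y) \<in> R)"
        using \<open>total R\<close> by (simp add: totalp_on_def total_on_def)
      ultimately show thesis
        using Finite_Set.bex_greatest_element[OF S, of "\<lambda>x y. (x, y) \<in> R"] that by blast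
    qed
    have "0 = (\<Sum>i\<in>S. int_mult (c i) i)"
      unfolding 0[symmetric] using F
    proof (intro sum.mono_neutral_right ballI)
      fix i assume "i \<in> F - S"
      then have "[c i = 0] (mod int p)"
        by (simp add: S_def cong_0_iff)
      from int_mult_cong[OF exp this] show "int_mult (c i) i = 0"
        by simp
    qed (auto simp: S_def)
    also have "\<dots> = int_mult (c m) m + (\<Sum>i\<in>S - {m}. int_mult (c i) i)"
      using \<open>m \<in> S\<close> by (rule sum.remove[OF S(1)])
    finally have "int_mult (c m) m = - (\<Sum>i\<in>S - {m}. int_mult (c i) i)"
      by (simp add: eq_neg_iff_add_eq_0)
    moreover have "(\<Sum>i\<in>S - {m}. int_mult (c i) i) \<in> zmod.span {h. (h, m) \<in> R}"
      using m by (intro zmod.span_sum zmod.span_scale zmod.span_base) auto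
    ultimately have cm: "int_mult (c m) m \<in> zmod.span {h. (h, m) \<in> R}"
      by (simp add: zmod.span_neg)
    have "\<not> int p dvd c m"
      using \<open>m \<in> S\<close> by (simp add: S_def)
    then obtain b where "m = int_mult b (int_mult (c m) m)"
      using int_mult_left_inverse[OF assms(1) exp] by metis
    also have "\<dots> \<in> zmod.span {h. (h, m) \<in> R}"
      using cm by (rule zmod.span_scale)
    finally show False
      using \<open>m \<in> S\<close> F by (auto simp: S_def I_def)
  qed
  show ?thesis
    by (rule exI[of _ I]) (auto simp: span dest: indep)
qed

lemma carrier_cyclic_sum:
  assumes "p > 0"
  shows "carrier (cyclic_sum p I) = {x \<in> \<Pi>\<^sub>E i\<in>I. {0..<int p}. finite {i \<in> I. x i \<noteq> 0}}"
  using assms by (simp add: cyclic_sum_def carrier_sum_group carrier_integer_mod_group)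

lemma cyclic_sum_pow:
  fixes n :: nat
  assumes "x \<in> carrier (cyclic_sum p I)" "p > 0"
  shows "x [^]\<^bsub>cyclic_sum p I\<^esub> n = (\<lambda>i\<in>I. (int n * x i) mod int p)"
proof (induction n)
  case 0
  show ?case
    by (simp add: cyclic_sum_def restrict_def fun_eq_iff)
next
  case (Suc n)
  have "((int n * x i) mod int p + x i) mod int p = (int (Suc n) * x i) mod int p" for i
    by (simp add: mod_simps algebra_simps)
  with Suc show ?case
    by (simp add: cyclic_sum_def fun_eq_iff)
qed

lemma group_cyclic_sum: "group (cyclic_sum p I)"
  by (simp add: cyclic_sum_def)

lemma iso_cyclic_sum_imp_exponent:
  fixes g :: "'g::ab_group_add"
  assumes "type_group TYPE('g) \<cong> cyclic_sum p I" "p > 0"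
  shows "int_mult (int p) g = 0"
proof -
  obtain h where h: "h \<in> iso (cyclic_sum p I) (type_group TYPE('g))"
    using group.iso_sym[OF comm_group.axioms(2)[OF comm_group_type_group] assms(1)]
    by (auto simp: is_iso_def)
  interpret group_hom "cyclic_sum p I" "type_group TYPE('g)" h
    using h comm_group.axioms(2)[OF comm_group_type_group]
    by (simp add: group_hom_def group_hom_axioms_def group_cyclic_sum iso_def)
  have "g \<in> h ` carrier (cyclic_sum p I)"
    using h by (simp add: iso_def bij_betw_def type_group_def)
  then obtain x where x: "x \<in> carrier (cyclic_sum p I)" "h x = g"
    by blast
  have "x [^]\<^bsub>cyclic_sum p I\<^esub> p = \<one>\<^bsub>cyclic_sum p I\<^esub>"
    using cyclic_sum_pow[OF x(1) assms(2)] by (simp add: cyclic_sum_def restrict_def fun_eq_iff)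
  then have "h x [^]\<^bsub>type_group TYPE('g)\<^esub> p = \<one>\<^bsub>type_group TYPE('g)\<^esub>"
    using hom_nat_pow[OF x(1), of p] by simp
  then show ?thesis
    by (simp add: int_mult_def int_pow_int x type_group_def)
qed

text \<open>
  The isomorphism sends a family of residues to the linear combination of the basis with these
  coefficients. The cyclic summands consist of the representatives in \<open>{0..<p}\<close>, so injectivity
  turns a congruence of coefficients into an equality.
\<close>

lemma exponent_imp_iso_cyclic_sum:
  assumes "prime p" and exp: "\<And>g::'g::ab_group_add. int_mult (int p) g = 0"
    and "\<exists>g::'g. g \<noteq> 0"
  shows "\<exists>I::'g set. I \<noteq> {} \<and> type_group TYPE('g) \<cong> cyclic_sum p I"
proof -
  obtain I :: "'g set" where span: "zmod.span I = UNIV"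
    and indep: "\<And>F c. \<lbrakk>finite F; F \<subseteq> I; (\<Sum>i\<in>F. int_mult (c i) i) = 0\<rbrakk> \<Longrightarrow> \<forall>i\<in>F. int p dvd c i"
    using exists_independent_spanning_set[OF assms(1) exp] by (elim exE conjE) simp
  have "p > 0"
    using assms(1) by (rule prime_gt_0_nat)
  note carrier = carrier_cyclic_sum[OF this]
  define \<phi> where "\<phi> x = (\<Sum>i | i \<in> I \<and> x i \<noteq> 0. int_mult (x i) i)" for x
  \<comment> \<open>Enlarging the support to any finite set allows two families to share one index set.\<close>
  have \<phi>: "\<phi> x = (\<Sum>i\<in>F. int_mult (x i) i)"
    if "finite F" "F \<subseteq> I" "{i \<in> I. x i \<noteq> 0} \<subseteq> F" for x F
    unfolding \<phi>_def using that by (intro sum.mono_neutral_left) auto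
  have "\<phi> \<in> iso (cyclic_sum p I) (type_group TYPE('g))"
  proof (rule isoI)
    show "\<phi> \<in> hom (cyclic_sum p I) (type_group TYPE('g))"
    proof (rule homI)
      fix x y
      assume xy: "x \<in> carrier (cyclic_sum p I)" "y \<in> carrier (cyclic_sum p I)"
      define F where "F = {i \<in> I. x i \<noteq> 0} \<union> {i \<in> I. y i \<noteq> 0}"
      define z where "z = x \<otimes>\<^bsub>cyclic_sum p I\<^esub> y"
      have z: "z i = (x i + y i) mod int p" if "i \<in> I" for i
        using that by (simp add: z_def cyclic_sum_def)
      have F: "finite F" "F \<subseteq> I"
        using xy by (auto simp: F_def carrier)
      have "\<phi> z = (\<Sum>i\<in>F. int_mult (z i) i)"
        by (rule \<phi>[OF F]) (auto simp: F_def z)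
      also have "\<dots> = (\<Sum>i\<in>F. int_mult (x i) i + int_mult (y i) i)"
      proof (rule sum.cong[OF refl])
        fix i assume "i \<in> F"
        then have "[z i = x i + y i] (mod int p)"
          using F by (auto simp: z)
        from int_mult_cong[OF exp this] show "int_mult (z i) i = int_mult (x i) i + int_mult (y i) i"
          by (simp add: zmod.scale_left_distrib)
      qed
      also have "\<dots> = \<phi> x + \<phi> y"
        by (subst (1 2) \<phi>[OF F]) (auto simp: F_def sum.distrib)
      finally show "\<phi> (x \<otimes>\<^bsub>cyclic_sum p I\<^esub> y) = \<phi> x \<otimes>\<^bsub>type_group TYPE('g)\<^esub> \<phi> y"
        by (simp add: z_def type_group_def)
    qed (simp add: type_group_def)
  next
    show "bij_betw \<phi> (carrier (cyclic_sum p I)) (carrier (type_group TYPE('g)))"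
      unfolding bij_betw_def
    proof
      show "inj_on \<phi> (carrier (cyclic_sum p I))"
      proof (rule inj_onI)
        fix x y
        assume xy: "x \<in> carrier (cyclic_sum p I)" "y \<in> carrier (cyclic_sum p I)" "\<phi> x = \<phi> y"
        define F where "F = {i \<in> I. x i \<noteq> 0} \<union> {i \<in> I. y i \<noteq> 0}"
        have F: "finite F" "F \<subseteq> I"
          using xy by (auto simp: F_def carrier)
        have "(\<Sum>i\<in>F. int_mult (x i - y i) i) = \<phi> x - \<phi> y"
          by (subst (1 2) \<phi>[OF F]) (auto simp: F_def sum_subtractf zmod.scale_left_diff_distrib)
        then have dvd: "\<forall>i\<in>F. int p dvd x i - y i"
          using indep[OF F] xy(3) by simp
        show "x = y"
        proof (rule extensionalityI)
          fix i assume "i \<in> I"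
          then have bounds: "x i \<in> {0..<int p}" "y i \<in> {0..<int p}"
            using xy by (auto simp: carrier)
          show "x i = y i"
          proof (cases "i \<in> F")
            case True
            then have "[x i = y i] (mod int p)"
              using dvd by (simp add: cong_iff_dvd_diff)
            then show ?thesis
              using bounds by (simp add: cong_def)
          qed (use \<open>i \<in> I\<close> in \<open>auto simp: F_def\<close>)
        qed (use xy in \<open>auto simp: carrier PiE_def\<close>)
      qed
      have "g \<in> \<phi> ` carrier (cyclic_sum p I)" for g
      proof -
        have "g \<in> zmod.span I"
          by (simp add: span)
        then obtain t r where t: "finite t" "t \<subseteq> I" and g: "g = (\<Sum>a\<in>t. int_mult (r a) a)"
          by (auto simp: zmod.span_explicit)
        define x where "x = (\<lambda>i\<in>I. if i \<in> t then r i mod int p else 0)"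
        have supp: "{i \<in> I. x i \<noteq> 0} \<subseteq> t"
          by (auto simp: x_def split: if_splits)
        then have "x \<in> carrier (cyclic_sum p I)"
          using \<open>p > 0\<close> t finite_subset by (auto simp: carrier x_def)
        moreover have "\<phi> x = g"
          unfolding \<phi>[OF t supp] g
        proof (rule sum.cong[OF refl])
          fix i assume "i \<in> t"
          then have "[x i = r i] (mod int p)"
            using t by (auto simp: x_def)
          then show "int_mult (x i) i = int_mult (r i) i"
            by (rule int_mult_cong[OF exp])
        qed
        ultimately show ?thesis
          by blast
      qed
      then show "\<phi> ` carrier (cyclic_sum p I) = carrier (type_group TYPE('g))"
        by (auto simp: type_group_def)
    qed
  qed
  then have "type_group TYPE('g) \<cong> cyclic_sum p I"
    by (meson group.iso_sym group_cyclic_sum is_isoI)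
  moreover have "I \<noteq> {}"
    using span assms(3) by auto
  ultimately show ?thesis
    by blast
qed

section \<open>Fields whose nonzero elements are roots of unity of prime order\<close>

text \<open>
  Lagrange's theorem for the multiplicative group of the field: multiplication by \<open>c\<close> permutes the
  nonzero elements, so it does not change their product.
\<close>

lemma finite_field_power_card_minus_1:
  fixes c :: "'k::field"
  assumes "finite (UNIV :: 'k set)" "c \<noteq> 0"
  shows "c ^ (card (UNIV :: 'k set) - 1) = 1"
proof -
  have "\<Prod>(UNIV - {0}) = (\<Prod>y\<in>UNIV - {0}. c * y)"
    by (rule prod.reindex_bij_witness[of _ "\<lambda>y. c * y" "\<lambda>y. y / c"]) (use assms in auto)
  also have "\<dots> = c ^ (card (UNIV :: 'k set) - 1) * \<Prod>(UNIV - {0})"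
    using assms by (simp add: prod.distrib card_Diff_singleton)
  finally show ?thesis
    using assms by simp
qed

text \<open>
  A polynomial of degree \<open>p\<close> bounds the number of nonzero elements by \<open>p\<close>. An element other than 0
  and 1 has multiplicative order exactly \<open>p\<close>, so its powers attain this bound.
\<close>

lemma is_GF_if_nonzero_power_prime_eq_1:
  assumes "prime p" and root: "\<And>c::'k::field. c \<noteq> 0 \<Longrightarrow> c ^ p = 1"
  shows "is_GF 2 TYPE('k) \<or> is_GF (p + 1) TYPE('k)"
proof -
  have "p > 0"
    using assms(1) by (rule prime_gt_0_nat)
  define f :: "'k poly" where "f = Polynomial.monom 1 p - 1"
  have "f \<noteq> 0"
  proof
    assume "f = 0"
    then have "poly f 0 = 0" by simp
    with \<open>p > 0\<close> show False
      by (simp add: f_def poly_monom power_0_left)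
  qed
  have "Polynomial.degree f \<le> p"
    unfolding f_def by (rule degree_diff_le) (simp_all add: degree_monom_le)
  have roots: "{c. poly f c = 0} = UNIV - {0}"
    using root \<open>p > 0\<close> by (auto simp: f_def poly_monom power_0_left)
  then have fin: "finite (UNIV :: 'k set)"
    using poly_roots_finite[OF \<open>f \<noteq> 0\<close>] by simp
  have le: "card (UNIV - {0 :: 'k}) \<le> p"
    using card_poly_roots_bound[OF \<open>f \<noteq> 0\<close>] \<open>Polynomial.degree f \<le> p\<close> roots by simp
  have card: "card (UNIV :: 'k set) = card (UNIV - {0 :: 'k}) + 1"
    using card.remove[OF fin, of 0] by simp
  show ?thesis
  proof (cases "\<exists>c::'k. c \<noteq> 0 \<and> c \<noteq> 1")
    case False
    then have "UNIV = {0, 1 :: 'k}"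
      by auto
    then have "card (UNIV :: 'k set) = card {0, 1 :: 'k}"
      by simp
    then show ?thesis
      using fin by (simp add: is_GF_def)
  next
    case True
    then obtain c :: 'k where c: "c \<noteq> 0" "c \<noteq> 1"
      by blast
    have *: "c ^ i \<noteq> c ^ j" if ij: "i < j" "j < p" for i j
    proof
      assume "c ^ i = c ^ j"
      also have "\<dots> = c ^ i * c ^ (j - i)"
        using that by (simp flip: power_add)
      \<comment> \<open>The exponents \<open>p\<close> and \<open>j - i\<close> are coprime, and both give the power 1, so \<open>c = 1\<close>.\<close>
      finally have 1: "c ^ (j - i) = 1"
        using c by simp
      have "coprime p (j - i)"
        using that assms(1) by (intro prime_imp_coprime) (auto dest: dvd_imp_le)
      then have "gcd (j - i) p = 1"
        by (simp add: gcd.commute)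
      then obtain x y where "(j - i) * x = p * y + 1"
        using bezout_nat[of "j - i" p] ij by auto
      then have "(c ^ (j - i)) ^ x = (c ^ p) ^ y * c"
        by (metis power_add power_mult power_one_right)
      then show False
        using 1 c root by simp
    qed
    then have "inj_on (\<lambda>i. c ^ i) {..<p}"
      by (metis inj_onI lessThan_iff linorder_neqE_nat)
    then have "card {..<p} \<le> card (UNIV - {0 :: 'k})"
      by (rule card_inj_on_le) (use c fin in auto)
    then have "card (UNIV :: 'k set) = p + 1"
      using le card by (simp only: card_lessThan)
    then show ?thesis
      using fin by (simp add: is_GF_def)
  qed
qed

section \<open>Group algebras in characteristic two\<close>

lemma CHAR_group_algebra: "CHAR('g::ab_group_add \<Rightarrow>\<^sub>0 'k::field) = CHAR('k)"
proof (rule CHAR_eqI)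
  show "of_nat CHAR('k) = (0 :: 'g \<Rightarrow>\<^sub>0 'k)"
    by (metis of_nat_CHAR single_of_nat single_zero)
next
  fix n assume "of_nat n = (0 :: 'g \<Rightarrow>\<^sub>0 'k)"
  then have "Poly_Mapping.lookup (of_nat n :: 'g \<Rightarrow>\<^sub>0 'k) 0 = 0"
    by simp
  then have "of_nat n = (0 :: 'k)"
    by (simp add: lookup_of_nat)
  then show "CHAR('k) dvd n"
    by (simp add: of_nat_eq_0_iff_char_dvd)
qed

lemma single_power:
  fixes g :: "'g::ab_group_add" and c :: "'k::field"
  shows "Poly_Mapping.single g c ^ n = Poly_Mapping.single (int_mult (int n) g) (c ^ n)"
  by (induction n) (simp_all add: mult_single zmod.scale_left_distrib)

lemma poly_mapping_eq_sum_single: "a = (\<Sum>g\<in>Poly_Mapping.keys a. Poly_Mapping.single g (Poly_Mapping.lookup a g))"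
  by (rule poly_mapping_eqI)
    (auto simp: lookup_sum lookup_single when_def in_keys_iff)

text \<open>
  In characteristic 2 the \<open>2\<^sup>n\<close>-th power is additive, so it suffices to look at the terms
  \<open>c g\<close> of an element of the group algebra.
\<close>

lemma group_algebra_power_eq_same:
  fixes a :: "'g::ab_group_add \<Rightarrow>\<^sub>0 'k::field"
  assumes "CHAR('k) = 2"
    and "\<And>c::'k. c ^ 2 ^ n = c" and "\<And>g::'g. int_mult (2 ^ n) g = g"
  shows "a ^ 2 ^ n = a"
proof -
  let ?S = "\<lambda>g. Poly_Mapping.single g (Poly_Mapping.lookup a g)"
  have "a ^ 2 ^ n = (\<Sum>g\<in>Poly_Mapping.keys a. ?S g) ^ 2 ^ n"
    by (simp flip: poly_mapping_eq_sum_single)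
  also have "\<dots> = (\<Sum>g\<in>Poly_Mapping.keys a. ?S g ^ 2 ^ n)"
    by (rule freshmans_dream_sum') (simp_all add: CHAR_group_algebra assms(1))
  also have "\<dots> = a"
    by (simp add: single_power assms flip: poly_mapping_eq_sum_single)
  finally show ?thesis .
qed

lemma delta_ring_single_power:
  fixes g :: "'g::ab_group_add" and c :: "'k::field"
  assumes "delta_ring p TYPE(('k, 'g) group_algebra)" "c \<noteq> 0"
  shows "int_mult (int p) g = 0" "c ^ p = 1"
proof -
  let ?u = "Poly_Mapping.single g c" and ?v = "Poly_Mapping.single (- g) (inverse c)"
  have "?u * ?v = 1" "?v * ?u = 1"
    using assms(2) by (simp_all add: mult_single)
  then have "?u ^ p = 1"
    using assms(1) by (auto simp: delta_ring_def)
  then have *: "Poly_Mapping.single (int_mult (int p) g) (c ^ p) = Poly_Mapping.single 0 1"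
    by (simp add: single_power)
  then have "Poly_Mapping.lookup (Poly_Mapping.single (int_mult (int p) g) (c ^ p)) 0 = 1"
    by simp
  then show "int_mult (int p) g = 0" "c ^ p = 1"
    by (auto simp: lookup_single when_def split: if_splits)
qed

text \<open>
  In a product of fields, \<open>u\<close> below agrees with \<open>a\<close> where \<open>a\<close> does not vanish and is 1 elsewhere.
  This makes it a unit from which \<open>a\<close> can be recovered, so \<open>u\<^sup>p = 1\<close> turns into a statement about
  the arbitrary element \<open>a\<close>.
\<close>

lemma delta_ring_power_Suc_eq_same:
  fixes a :: "'a::comm_ring_1"
  assumes "delta_ring p TYPE('a)" and "a ^ N = a" "N \<ge> 3"
  shows "a ^ Suc p = a"
proof -
  obtain M where N: "N = Suc (Suc (Suc M))"
    using \<open>N \<ge> 3\<close> by (metis Suc_le_D numeral_3_eq_3 Suc_le_mono)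
  define b where "b = a ^ Suc M"
  define e where "e = a * b"
  define u where "u = a + 1 - e"
  have ae: "a * e = a"
    using assms(2) by (simp add: N e_def b_def)
  have eb: "e * b = b"
    using ae by (simp add: b_def) (metis mult.assoc mult.commute)
  have ee: "e * e = e"
    using ae e_def by (metis mult.assoc mult.commute)
  \<comment> \<open>The inverse of \<open>u\<close> is built in the same way from the power \<open>b\<close> with \<open>a b = e\<close>.\<close>
  have "u * (b + 1 - e) = a * b + a - a * e + b + 1 - e - e * b - e + e * e"
    by (simp add: u_def algebra_simps)
  also have "\<dots> = 1"
    by (simp add: ae eb ee flip: e_def)
  finally have "u ^ p = 1"
    using assms(1) by (auto simp: delta_ring_def mult.commute)
  have au: "a * u = a * a"
    by (simp add: u_def algebra_simps ae)
  have "a * u ^ n = a ^ Suc n" for n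
  proof (induction n)
    case (Suc n)
    have "a * u ^ Suc n = (a * u ^ n) * u"
      by (simp add: mult_ac)
    also have "\<dots> = a ^ n * (a * u)"
      by (simp add: Suc mult_ac)
    finally show ?case
      by (simp add: au mult_ac)
  qed simp
  from this[of p] show ?thesis
    using \<open>u ^ p = 1\<close> by simp
qed

text \<open>
  Write \<open>p + 1 = 2\<^sup>s m\<close> with \<open>m\<close> odd, and let \<open>h = g^(2^s)\<close>, which has order \<open>p\<close>, too. The identity
  \<open>(1 + g)^(p + 1) = 1 + g\<close> becomes \<open>(1 + h)^m = 1 + h^m\<close>. Because \<open>m < p\<close>, the powers of \<open>h\<close> in the
  binomial expansion are distinct, and \<open>h\<close> itself has the coefficient \<open>m\<close>, which is odd. Hence
  \<open>h\<close> occurs on the right, which is only possible for \<open>m = 1\<close>.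
\<close>

lemma mersenne_prime_if_delta_ring:
  fixes g :: "'g::ab_group_add"
  assumes delta: "delta_ring p TYPE(('k::field, 'g) group_algebra)"
    and p: "prime p" "odd p" and char: "CHAR('k) = 2"
    and exp: "\<And>h::'g. int_mult (int p) h = 0" and "g \<noteq> 0"
  shows "mersenne_prime p"
proof -
  let ?X = "\<lambda>h::'g. Poly_Mapping.single h (1 :: 'k)"
  have p3: "p \<ge> 3"
    using p prime_ge_2_nat[of p] by (cases "p = 2") auto
  have frob: "(1 + ?X h) ^ 2 ^ n = 1 + ?X (int_mult (2 ^ n) h)" for h n
    using freshmans_dream'[of "2 ^ n" n 1 "?X h"] by (simp add: CHAR_group_algebra char single_power)
  have "(1 + ?X g) ^ 2 ^ (p - 1) = 1 + ?X g"
  proof -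
    have "\<not> p dvd 2"
      using p3 by (auto dest: dvd_imp_le)
    then have "[2 ^ (p - 1) = 1] (mod p)"
      by (rule fermat_theorem[OF p(1)])
    then have "[2 ^ (p - 1) = 1] (mod int p)"
      using cong_int_iff[of "2 ^ (p - 1)" 1 p] by simp
    from int_mult_cong[OF exp this] show ?thesis
      by (simp add: frob)
  qed
  moreover have "(2::nat) ^ (p - 1) \<ge> 3"
    using power_increasing[of 2 "p - 1" "2::nat"] p3 by force
  ultimately have same: "(1 + ?X g) ^ Suc p = 1 + ?X g"
    by (rule delta_ring_power_Suc_eq_same[OF delta])
  obtain m where "Suc p = 2 ^ multiplicity 2 (Suc p) * m" "\<not> 2 dvd m"
    using multiplicity_decompose'[of "Suc p" "2::nat"] by auto
  then obtain s where m: "Suc p = 2 ^ s * m" "odd m"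
    by blast
  have "s > 0"
    using m p by (cases s) auto
  have "m < p"
  proof -
    have "2 * m \<le> 2 ^ s * m"
      using \<open>s > 0\<close> by (cases s) auto
    then show ?thesis
      using m(1) p3 by linarith
  qed
  define h where "h = int_mult (2 ^ s) g"
  have mh: "int_mult (int m) h = g"
  proof -
    have "int_mult (int m) h = int_mult (int (Suc p)) g"
      unfolding m(1) by (simp add: h_def mult.commute)
    also have "\<dots> = g"
      using exp by (simp add: zmod.scale_left_distrib)
    finally show ?thesis .
  qed
  then have "h \<noteq> 0"
    using \<open>g \<noteq> 0\<close> by auto
  have inj: "int_mult (int j) h = h \<longleftrightarrow> j = 1" if "j < p" for j
  proof
    assume "int_mult (int j) h = h"
    then have "int_mult (int j - 1) h = 0"
      by (simp add: zmod.scale_left_diff_distrib)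
    then have "int p dvd int j - 1"
      using int_mult_left_inverse[OF p(1) exp, of "int j - 1" h] \<open>h \<noteq> 0\<close> by fastforce
    then have "[int j = int 1] (mod int p)"
      by (simp add: cong_iff_dvd_diff)
    then have "[j = 1] (mod p)"
      by (simp only: cong_int_iff)
    then show "j = 1"
      using that p3 by (simp add: cong_def)
  qed simp
  \<comment> \<open>The coefficient of \<open>h\<close> on both sides shows that \<open>g = h\<close>.\<close>
  have "1 + ?X g = (1 + ?X h) ^ m"
    using same unfolding m(1) power_mult frob by (simp add: h_def)
  also have "\<dots> = (\<Sum>j\<le>m. of_nat (m choose j) * ?X h ^ j)"
    using binomial_ring[of "?X h" 1 m] by (simp add: add.commute)
  also have "\<dots> = (\<Sum>j\<le>m. Poly_Mapping.single (int_mult (int j) h) (of_nat (m choose j)))"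
    by (simp add: single_power mult_single flip: single_of_nat)
  finally have "Poly_Mapping.lookup (1 + ?X g) h =
      (\<Sum>j\<le>m. of_nat (m choose j) when int_mult (int j) h = h)"
    by (simp add: lookup_sum lookup_single)
  also have "\<dots> = (\<Sum>j\<le>m. of_nat (m choose j) when j = 1)"
    using \<open>m < p\<close> by (intro sum.cong) (auto simp: inj)
  also have "\<dots> = of_nat m"
    using m(2) by (auto simp: when_def sum.delta' elim: oddE)
  also have "\<dots> \<noteq> (0 :: 'k)"
    using m(2) char by (simp add: of_nat_eq_0_iff_char_dvd)
  finally have "g = h"
    using \<open>h \<noteq> 0\<close> by (auto simp: lookup_add lookup_one lookup_single when_def split: if_splits)
  then have "m = 1"
    using mh inj[OF \<open>m < p\<close>] by simp
  then have "p = 2 ^ s - 1"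
    using m(1) by simp
  with p \<open>s > 0\<close> show ?thesis
    by (auto simp: mersenne_prime_def)
qed

theorem theorem1p5:
  fixes p :: nat
  assumes "\<exists>g::'g::ab_group_add. g \<noteq> 0"
    and "prime p" and "odd p"
  shows "delta_ring p TYPE(('k::field, 'g) group_algebra) \<longleftrightarrow>
    mersenne_prime p \<and>
    (is_GF 2 TYPE('k) \<or> is_GF (p + 1) TYPE('k)) \<and>
    (\<exists>I::'g set. I \<noteq> {} \<and> type_group TYPE('g) \<cong> cyclic_sum p I)"
    (is "?delta \<longleftrightarrow> ?structure")
proof
  assume delta: ?delta
  have exp: "int_mult (int p) g = 0" for g :: 'g
    using delta_ring_single_power(1)[OF delta, of 1] by simp
  have root: "c ^ p = 1" if "c \<noteq> 0" for c :: 'k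
    using delta_ring_single_power(2)[OF delta that] .
  have "of_nat 2 = (0 :: 'k)"
    using root[of "- 1"] \<open>odd p\<close> by (simp add: neg_eq_iff_add_eq_0)
  then have "CHAR('k) dvd 2"
    by (simp only: of_nat_eq_0_iff_char_dvd)
  then have char: "CHAR('k) = 2"
    using CHAR_not_1' two_is_prime_nat by (metis One_nat_def prime_nat_iff)
  show ?structure
    using mersenne_prime_if_delta_ring[OF delta assms(2,3) char exp] assms(1)
      is_GF_if_nonzero_power_prime_eq_1[OF assms(2) root]
      exponent_imp_iso_cyclic_sum[OF assms(2) exp assms(1)]
    by blast
next
  assume struct: ?structure
  then obtain n where n: "p + 1 = 2 ^ n" "n > 0"
    by (auto simp: mersenne_prime_def)
  have card: "card (UNIV :: 'k set) = 2 \<or> card (UNIV :: 'k set) = 2 ^ n"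
    and fin: "finite (UNIV :: 'k set)"
    using struct n(1) by (auto simp: is_GF_def)
  have "CHAR('k) dvd 2 ^ n"
    using CHAR_dvd_CARD[where 'a='k] card n(2) by (auto intro: dvd_trans)
  moreover have "prime CHAR('k)"
    using fin by (simp add: finite_imp_CHAR_pos prime_CHAR_semidom)
  ultimately have char: "CHAR('k) = 2"
    using prime_dvd_power primes_dvd_imp_eq two_is_prime_nat by blast
  have field: "c ^ 2 ^ n = c" for c :: 'k
  proof (cases "c = 0")
    case False
    from finite_field_power_card_minus_1[OF fin False] have "c ^ p = 1"
      using card by (auto simp flip: n(1))
    then show ?thesis
      by (simp flip: n(1))
  qed (use n in simp)
  have exp: "int_mult (int p) g = 0" for g :: 'g
    using struct iso_cyclic_sum_imp_exponent prime_gt_0_nat[OF assms(2)] by blast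
  have group: "int_mult (2 ^ n) g = g" for g :: 'g
  proof -
    have "2 ^ n = int p + 1"
      using n(1) by (metis of_nat_1 of_nat_add of_nat_numeral of_nat_power)
    then show ?thesis
      by (simp add: zmod.scale_left_distrib exp)
  qed
  show ?delta
    unfolding delta_ring_def
  proof (intro allI impI)
    fix u :: "('k, 'g) group_algebra"
    assume "\<exists>v. u * v = 1 \<and> v * u = 1"
    then obtain v where v: "v * u = 1"
      by blast
    have "u ^ p = v * u ^ (p + 1)"
      using v by (simp add: flip: mult.assoc)
    also have "\<dots> = v * u"
      unfolding n(1) by (simp add: group_algebra_power_eq_same[OF char field group])
    finally show "u ^ p = 1"
      by (simp add: v)
  qed
qed

end
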